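(* For every $\lambda\in\mathbb{C}$ and every $k\in\mathbb{N}$, $$V_k(\lambda V_0,\lambda^2V_1,\lambda^3V_2)=\lambda^{k+1}V_k(V_0,V_1,V_2),$$ i.e. the function $V_k(V_0,V_1,V_2)$ is quasihomogeneous of type $(1,2,3)$ and degree $k+1$.
   Context: Fix integers $N\ge 1$ and $0\le m\le N$ and put $V_{-1}=\begin{pmatrix}-2I_m&0\\0&0\end{pmatrix}\in M_N(\mathbb{C})$. For $k\ge2$, $T_k:M_N(\mathbb{C})\to M_N(\mathbb{C})$ is the linear operator $T_k(a)=k(k-1)a+V_{-1}a-k\,aV_{-1}$, invertible for $k\ge3$. Here $V_0,V_1,V_2\in M_N(\mathbb{C})$ satisfy $V_{-1}V_0=V_{-1}V_1=0$ and $T_2(V_2)=V_1V_0$. The matrices $V_k=V_k(V_0,V_1,V_2)$, $k\in\mathbb{N}=\{0,1,2,\dots\}$, are $V_0,V_1,V_2$ themselves for $k=0,1,2$, and $V_k=\sum_{j=1}^{k-1}j\,T_k^{-1}(V_jV_{k-1-j})$ recursively for $k\ge3$. *)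

theory Defs
  imports "Jordan_Normal_Form.Matrix"
begin

text \<open>The matrix \<open>V\<close> of index \<open>-1\<close>.\<close>

definition Vm1 :: "nat \<Rightarrow> nat \<Rightarrow> complex mat" where
  "Vm1 N m = four_block_mat
     ((-2) \<cdot>\<^sub>m 1\<^sub>m m)      (0\<^sub>m m (N - m))
     (0\<^sub>m (N - m) m)     (0\<^sub>m (N - m) (N - m))"

definition T_op :: "nat \<Rightarrow> nat \<Rightarrow> nat \<Rightarrow> complex mat \<Rightarrow> complex mat" where
  "T_op N m k a = of_nat (k * (k - 1)) \<cdot>\<^sub>m a + Vm1 N m * a - of_nat k \<cdot>\<^sub>m (a * Vm1 N m)"

text \<open>The inverse is only meaningful where \<^const>\<open>T_op\<close> is bijective on the \<open>N \<times> N\<close> matrices;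
  see \<open>T_op_bij\<close> below for \<open>k \<ge> 3\<close>.\<close>

definition T_inv :: "nat \<Rightarrow> nat \<Rightarrow> nat \<Rightarrow> complex mat \<Rightarrow> complex mat" where
  "T_inv N m k = the_inv_into (carrier_mat N N) (T_op N m k)"

text \<open>Matrices of unspecified dimension form no \<^class>\<open>comm_monoid_add\<close>, so \<^const>\<open>sum\<close> is not
  available on them; the sum of a family of \<open>N \<times> N\<close> matrices is taken entrywise.\<close>

definition mat_sum :: "nat \<Rightarrow> ('i \<Rightarrow> complex mat) \<Rightarrow> 'i set \<Rightarrow> complex mat" where
  "mat_sum N f J = mat N N (\<lambda>(r, c). \<Sum>j\<in>J. f j $$ (r, c))"

lemma mat_sum_cong [fundef_cong]:
  "J = J' \<Longrightarrow> (\<And>j. j \<in> J' \<Longrightarrow> f j = g j) \<Longrightarrow> mat_sum N f J = mat_sum N g J'"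
  unfolding mat_sum_def by (intro arg_cong[where f = "mat N N"] ext) (auto intro: sum.cong)

fun V_seq :: "nat \<Rightarrow> nat \<Rightarrow> complex mat \<Rightarrow> complex mat \<Rightarrow> complex mat \<Rightarrow> nat \<Rightarrow> complex mat" where
  "V_seq N m V0 V1 V2 k =
     (if k = 0 then V0
      else if k = 1 then V1
      else if k = 2 then V2
      else mat_sum N
        (\<lambda>j. of_nat j \<cdot>\<^sub>m
           T_inv N m k (V_seq N m V0 V1 V2 j * V_seq N m V0 V1 V2 (k - 1 - j)))
        {1..k - 1})"

declare V_seq.simps [simp del]

lemma Vm1_dim [simp]:
  assumes "m \<le> N"
  shows "dim_row (Vm1 N m) = N" "dim_col (Vm1 N m) = N"
  using assms unfolding Vm1_def by simp_all

lemma Vm1_carrier: "m \<le> N \<Longrightarrow> Vm1 N m \<in> carrier_mat N N"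
  by (intro carrier_matI) simp_all

lemma Vm1_index:
  assumes "m \<le> N" "i < N" "j < N"
  shows "Vm1 N m $$ (i, j) = (if i = j \<and> i < m then -2 else 0)"
proof -
  have "Vm1 N m $$ (i, j) = (if i < m \<and> j < m then ((-2) \<cdot>\<^sub>m 1\<^sub>m m) $$ (i, j) else 0)"
    unfolding Vm1_def using assms by (subst index_mat_four_block) simp_all
  then show ?thesis by simp
qed

lemma T_op_carrier:
  assumes "m \<le> N" "a \<in> carrier_mat N N"
  shows "T_op N m k a \<in> carrier_mat N N"
proof -
  have "a * Vm1 N m \<in> carrier_mat N N"
    using mult_carrier_mat[OF assms(2) Vm1_carrier[OF assms(1)]] .
  then show ?thesis
    unfolding T_op_def by (intro minus_carrier_mat smult_carrier_mat)
qed

text \<open>\<^const>\<open>T_op\<close> acts diagonally on the matrix units; its eigenvalue at the unit \<open>(i, j)\<close>:\<close>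

definition T_eig :: "nat \<Rightarrow> nat \<Rightarrow> nat \<Rightarrow> nat \<Rightarrow> complex" where
  "T_eig m k i j = of_nat (k * (k - 1)) - (if i < m then 2 else 0) + (if j < m then 2 * of_nat k else 0)"

lemma T_op_index:
  assumes "m \<le> N" "a \<in> carrier_mat N N" "i < N" "j < N"
  shows "T_op N m k a $$ (i, j) = T_eig m k i j * a $$ (i, j)"
proof -
  have d [simp]: "dim_row a = N" "dim_col a = N" using assms(2) by auto
  note [simp] = assms(1,3,4)
  have 1: "(Vm1 N m * a) $$ (i, j) = (if i < m then -2 else 0) * a $$ (i, j)"
  proof -
    have "(Vm1 N m * a) $$ (i, j) = (\<Sum>l\<in>{0..<N}. Vm1 N m $$ (i, l) * a $$ (l, j))"
      by (simp add: scalar_prod_def)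
    also have "\<dots> = (\<Sum>l\<in>{0..<N}. if l = i then (if i < m then -2 else 0) * a $$ (i, j) else 0)"
      by (intro sum.cong) (simp_all add: Vm1_index)
    finally show ?thesis by simp
  qed
  have 2: "(a * Vm1 N m) $$ (i, j) = (if j < m then -2 else 0) * a $$ (i, j)"
  proof -
    have "(a * Vm1 N m) $$ (i, j) = (\<Sum>l\<in>{0..<N}. a $$ (i, l) * Vm1 N m $$ (l, j))"
      by (simp add: scalar_prod_def)
    also have "\<dots> = (\<Sum>l\<in>{0..<N}. if l = j then (if j < m then -2 else 0) * a $$ (i, j) else 0)"
      by (intro sum.cong) (simp_all add: Vm1_index)
    finally show ?thesis by simp
  qed
  have "T_op N m k a $$ (i, j) =
    of_nat (k * (k - 1)) * a $$ (i, j) + (Vm1 N m * a) $$ (i, j) - of_nat k * (a * Vm1 N m) $$ (i, j)"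
    unfolding T_op_def by (simp del: index_mult_mat(1) of_nat_mult)
  also have "\<dots> = T_eig m k i j * a $$ (i, j)"
    unfolding 1 2 T_eig_def by (cases "i < m"; cases "j < m") (simp_all add: ring_distribs)
  finally show ?thesis .
qed

lemma T_eig_nonzero:
  assumes "3 \<le> k"
  shows "T_eig m k i j \<noteq> 0"
proof -
  obtain n where k: "k = 3 + n" using assms le_Suc_ex by blast
  define t :: nat where "t = n * n + 5 * n + 6"
  have "k * (k - 1) = t" unfolding k t_def by (simp add: algebra_simps)
  moreover have "(of_nat t :: complex) = of_nat (t - 2) + 2"
    unfolding t_def by (simp add: of_nat_diff)
  ultimately have "T_eig m k i j =
      of_nat ((if i < m then t - 2 else t) + (if j < m then 2 * k else 0))"
    unfolding T_eig_def by simp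
  moreover have "(if i < m then t - 2 else t) + (if j < m then 2 * k else 0) \<noteq> 0"
    unfolding t_def by simp
  ultimately show ?thesis by (metis of_nat_eq_0_iff)
qed

lemma T_op_bij:
  assumes "m \<le> N" "3 \<le> k"
  shows "bij_betw (T_op N m k) (carrier_mat N N) (carrier_mat N N)"
proof (rule bij_betwI[where g = "\<lambda>b :: complex mat. mat N N (\<lambda>(i, j). b $$ (i, j) / T_eig m k i j)"])
  show "T_op N m k \<in> carrier_mat N N \<rightarrow> carrier_mat N N"
    using T_op_carrier[OF assms(1)] by blast
  show "(\<lambda>b. mat N N (\<lambda>(i, j). b $$ (i, j) / T_eig m k i j)) \<in> carrier_mat N N \<rightarrow> carrier_mat N N"
    by auto
next
  fix a :: "complex mat" assume "a \<in> carrier_mat N N"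
  then show "mat N N (\<lambda>(i, j). T_op N m k a $$ (i, j) / T_eig m k i j) = a"
    using assms by (intro eq_matI) (auto simp: T_op_index T_eig_nonzero)
next
  fix b :: "complex mat" assume b: "b \<in> carrier_mat N N"
  let ?a = "mat N N (\<lambda>(i, j). b $$ (i, j) / T_eig m k i j)"
  have "T_op N m k ?a \<in> carrier_mat N N" by (rule T_op_carrier) (use assms in auto)
  then show "T_op N m k ?a = b"
    using assms b by (intro eq_matI) (auto simp: T_op_index T_eig_nonzero)
qed

end

theory Submission
  imports Defs
begin

text \<open>
  Give \<open>V_j\<close> the weight \<open>j + 1\<close>. For \<open>k \<ge> 3\<close> the recursion expresses \<open>V_k\<close> through the
  products \<open>V_j V_{k - 1 - j}\<close>, and every one of them has the same weight
  \<open>(j + 1) + (k - j) = k + 1\<close>, independently of \<open>j\<close>. Since \<open>T_k\<close> is linear and bijective, its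
  inverse commutes with scalars (\<open>T_inv_smult\<close>), so the common factor \<open>c ^ (k + 1)\<close> can be
  pulled out of the whole sum, and strong induction on \<open>k\<close> gives the claim. The prescribed
  scalings of \<open>V_0\<close>, \<open>V_1\<close>, \<open>V_2\<close> are the base cases.
\<close>

lemma T_inv_carrier:
  assumes "m \<le> N" "3 \<le> k" "b \<in> carrier_mat N N"
  shows "T_inv N m k b \<in> carrier_mat N N"
  using bij_betw_apply[OF bij_betw_the_inv_into[OF T_op_bij[OF assms(1,2)]] assms(3)]
  unfolding T_inv_def .

lemma T_op_T_inv:
  assumes "m \<le> N" "3 \<le> k" "b \<in> carrier_mat N N"
  shows "T_op N m k (T_inv N m k b) = b"
  using f_the_inv_into_f_bij_betw[OF T_op_bij[OF assms(1,2)]] assms(3)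
  unfolding T_inv_def by blast

lemma T_inv_T_op:
  assumes "m \<le> N" "3 \<le> k" "a \<in> carrier_mat N N"
  shows "T_inv N m k (T_op N m k a) = a"
  using the_inv_into_f_f[OF bij_betw_imp_inj_on[OF T_op_bij[OF assms(1,2)]] assms(3)]
  unfolding T_inv_def .

lemma T_op_smult:
  assumes "m \<le> N" "a \<in> carrier_mat N N"
  shows "T_op N m k (c \<cdot>\<^sub>m a) = c \<cdot>\<^sub>m T_op N m k a"
proof -
  have "T_op N m k (c \<cdot>\<^sub>m a) \<in> carrier_mat N N" "T_op N m k a \<in> carrier_mat N N"
    using assms by (auto intro: T_op_carrier)
  then show ?thesis
    using assms by (intro eq_matI) (auto simp: T_op_index)
qed

text \<open>Both sides have the same image under the injective linear map \<open>T_k\<close>.\<close>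

lemma T_inv_smult:
  assumes "m \<le> N" "3 \<le> k" "b \<in> carrier_mat N N"
  shows "T_inv N m k (c \<cdot>\<^sub>m b) = c \<cdot>\<^sub>m T_inv N m k b"
proof -
  have a: "T_inv N m k b \<in> carrier_mat N N"
    using assms by (rule T_inv_carrier)
  have "c \<cdot>\<^sub>m b = T_op N m k (c \<cdot>\<^sub>m T_inv N m k b)"
    by (simp add: T_op_smult[OF assms(1) a] T_op_T_inv[OF assms])
  then show ?thesis
    using T_inv_T_op[OF assms(1,2) smult_carrier_mat[OF a]] by simp
qed

lemma smult_smult_mat: "a \<cdot>\<^sub>m (b \<cdot>\<^sub>m A) = (a * b :: 'a :: semigroup_mult) \<cdot>\<^sub>m A"
  by (rule eq_matI) (simp_all add: mult.assoc)

lemma mat_sum_smult: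
  assumes "\<And>j. j \<in> J \<Longrightarrow> f j \<in> carrier_mat N N"
  shows "mat_sum N (\<lambda>j. c \<cdot>\<^sub>m f j) J = c \<cdot>\<^sub>m mat_sum N f J"
proof (rule eq_matI)
  fix r s
  assume "r < dim_row (c \<cdot>\<^sub>m mat_sum N f J)" "s < dim_col (c \<cdot>\<^sub>m mat_sum N f J)"
  then have rs: "r < N" "s < N" by (simp_all add: mat_sum_def)
  have "(\<Sum>j\<in>J. (c \<cdot>\<^sub>m f j) $$ (r, s)) = (\<Sum>j\<in>J. c * f j $$ (r, s))"
    using rs assms by (intro sum.cong refl) (metis carrier_matD index_smult_mat(1))
  then show "mat_sum N (\<lambda>j. c \<cdot>\<^sub>m f j) J $$ (r, s) = (c \<cdot>\<^sub>m mat_sum N f J) $$ (r, s)"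
    using rs by (simp add: mat_sum_def sum_distrib_left)
qed (simp_all add: mat_sum_def)

lemma V_seq_carrier:
  assumes "V0 \<in> carrier_mat N N" "V1 \<in> carrier_mat N N" "V2 \<in> carrier_mat N N"
  shows "V_seq N m V0 V1 V2 k \<in> carrier_mat N N"
  using assms by (subst V_seq.simps) (simp add: mat_sum_def)

theorem corollary3:
  fixes N m k :: nat and V0 V1 V2 :: "complex mat" and c :: complex
  assumes "N \<ge> 1" and "m \<le> N"
    and "V0 \<in> carrier_mat N N" and "V1 \<in> carrier_mat N N" and "V2 \<in> carrier_mat N N"
    and "Vm1 N m * V0 = 0\<^sub>m N N" and "Vm1 N m * V1 = 0\<^sub>m N N"
    and "T_op N m 2 V2 = V1 * V0"
  shows "V_seq N m (c \<cdot>\<^sub>m V0) (c ^ 2 \<cdot>\<^sub>m V1) (c ^ 3 \<cdot>\<^sub>m V2) k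
         = c ^ (k + 1) \<cdot>\<^sub>m V_seq N m V0 V1 V2 k"
proof (induction k rule: less_induct)
  case (less k)
  let ?V = "V_seq N m V0 V1 V2"
  let ?W = "V_seq N m (c \<cdot>\<^sub>m V0) (c ^ 2 \<cdot>\<^sub>m V1) (c ^ 3 \<cdot>\<^sub>m V2)"
  consider "k = 0" | "k = 1" | "k = 2" | "3 \<le> k" by linarith
  then show ?case
  proof cases
    case 4
    have V: "?V i \<in> carrier_mat N N" for i
      using assms(3-5) by (rule V_seq_carrier)
    have VV: "?V i * ?V j \<in> carrier_mat N N" for i j
      using V V by (rule mult_carrier_mat)
    have summand: "of_nat j \<cdot>\<^sub>m T_inv N m k (?W j * ?W (k - 1 - j))
        = c ^ (k + 1) \<cdot>\<^sub>m (of_nat j \<cdot>\<^sub>m T_inv N m k (?V j * ?V (k - 1 - j)))"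
      if "j \<in> {1..k - 1}" for j
    proof -
      have lt: "j < k" "k - 1 - j < k" using that 4 by auto
      have weight: "c ^ (j + 1) * c ^ (k - 1 - j + 1) = c ^ (k + 1)"
        using lt by (simp flip: power_add power_Suc)
      have "?W j * ?W (k - 1 - j)
          = (c ^ (j + 1) \<cdot>\<^sub>m ?V j) * (c ^ (k - 1 - j + 1) \<cdot>\<^sub>m ?V (k - 1 - j))"
        using less.IH[OF lt(1)] less.IH[OF lt(2)] by simp
      also have "\<dots> = (c ^ (j + 1) * c ^ (k - 1 - j + 1)) \<cdot>\<^sub>m (?V j * ?V (k - 1 - j))"
        by (simp only: mult_smult_assoc_mat[OF V smult_carrier_mat[OF V]]
            mult_smult_distrib[OF V V] smult_smult_mat)
      finally have "?W j * ?W (k - 1 - j) = c ^ (k + 1) \<cdot>\<^sub>m (?V j * ?V (k - 1 - j))"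
        by (simp only: weight)
      then show ?thesis
        by (simp only: T_inv_smult[OF assms(2) 4 VV] smult_smult_mat mult.commute)
    qed
    have "?W k = mat_sum N (\<lambda>j. of_nat j \<cdot>\<^sub>m T_inv N m k (?W j * ?W (k - 1 - j))) {1..k - 1}"
      using 4 by (subst V_seq.simps) simp
    also have "\<dots> = mat_sum N
        (\<lambda>j. c ^ (k + 1) \<cdot>\<^sub>m (of_nat j \<cdot>\<^sub>m T_inv N m k (?V j * ?V (k - 1 - j)))) {1..k - 1}"
      using summand by (rule mat_sum_cong[OF refl])
    also have "\<dots> = c ^ (k + 1) \<cdot>\<^sub>m
        mat_sum N (\<lambda>j. of_nat j \<cdot>\<^sub>m T_inv N m k (?V j * ?V (k - 1 - j))) {1..k - 1}"
      by (intro mat_sum_smult smult_carrier_mat T_inv_carrier[OF assms(2) 4 VV])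
    also have "mat_sum N (\<lambda>j. of_nat j \<cdot>\<^sub>m T_inv N m k (?V j * ?V (k - 1 - j))) {1..k - 1} = ?V k"
      using 4 by (subst (3) V_seq.simps) simp
    finally show ?thesis .
  qed (simp_all add: V_seq.simps power2_eq_square power3_eq_cube)
qed

end
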